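(* Define $T_0,T_1:\mathbb Z_{\ge0}\times\mathbb Z_{\ge0}\to\mathbb Z_{\ge0}$ by $$T_0(n,0)=1\ (n\ge0),\quad T_0(0,\ell)=1\ (\ell\ge1),$$ $$T_0(n,\ell)=T_0(n,\ell-1)+T_0(n-1,\ell)-\delta(n\ell\equiv_2 1)\binom{\frac{n+\ell}2-1}{\frac{\ell-1}2}\quad(n\ge1,\ \ell\ge1),$$ and $$T_1(n,0)=0\ (n\ge0),\quad T_1(0,\ell)=0\ (\ell\ge1),$$ $$T_1(n,\ell)=T_1(n,\ell-1)+T_1(n-1,\ell)+\delta(n\ell\equiv_2 1)\binom{\frac{n+\ell}2-1}{\frac{\ell-1}2}\quad(n\ge1,\ \ell\ge1).$$ Then for all $n\ge2$ one has $|\max^+_{C_n^{(1)}}(\ell\Lambda_0)|=T_0(n,\ell)$ for every $\ell\ge0$, and $|\max^+_{C_n^{(1)}}((\ell-1)\Lambda_0+\Lambda_1)|=T_1(n,\ell)$ for every $\ell\ge1$.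
   Context: $\delta(n\ell\equiv_21)$ equals $1$ if $n$ and $\ell$ are both odd and $0$ otherwise (in which case the term is absent). For an affine Kac--Moody algebra $\mathfrak g$ with null root $\delta$ and a dominant integral weight $\Lambda$, a weight $\mu$ of the irreducible highest weight module $V(\Lambda)$ is maximal if $\mu+\delta$ is not a weight of $V(\Lambda)$; $\max^+_{\mathfrak g}(\Lambda)$ is the set of maximal weights of $V(\Lambda)$ that are dominant integral. $C_n^{(1)}$ has the standard (Kac) labelling of its vertices by $0,1,\dots,n$ along the diagram, with canonical central element $\sum_{i=0}^n h_i$. *)

theory Defs
  imports Complex_Main
begin

section \<open>Affine Cartan matrices\<close>

text \<open>
  A generalized Cartan matrix indexed by \<open>{0..n}\<close>, indecomposable and of affine type. The vector
  \<open>a\<close> is the vector of marks: the coprime positive integers with \<open>A a = 0\<close>. Its existence is what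
  characterises affine type among indecomposable generalized Cartan matrices.
\<close>

locale affine_cartan_matrix =
  fixes n :: nat and A :: "nat \<Rightarrow> nat \<Rightarrow> int" and a :: "nat \<Rightarrow> nat"
  assumes diag: "i \<le> n \<Longrightarrow> A i i = 2"
    and off_diag: "\<lbrakk>i \<le> n; j \<le> n; i \<noteq> j\<rbrakk> \<Longrightarrow> A i j \<le> 0"
    and zero_sym: "\<lbrakk>i \<le> n; j \<le> n; A i j = 0\<rbrakk> \<Longrightarrow> A j i = 0"
    and indecomposable:
      "\<lbrakk>J \<noteq> {}; J \<subset> {..n}\<rbrakk> \<Longrightarrow> \<exists>i\<in>J. \<exists>j\<in>{..n} - J. A i j \<noteq> 0"
    and marks_pos: "i \<le> n \<Longrightarrow> a i > 0"
    and marks_coprime: "Gcd (a ` {..n}) = 1"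
    and marks_kernel: "i \<le> n \<Longrightarrow> (\<Sum>j\<le>n. A i j * int (a j)) = 0"

text \<open>
  The matrix \<open>(\<alpha>\<^sub>j(h\<^sub>i))\<close> of type \<open>C\<^sub>n\<^sup>(\<^sup>1\<^sup>)\<close> in Kac's labelling, for \<open>n \<ge> 2\<close>:
  \<open>0 \<Rightarrow> 1 - 2 - \<dots> - (n-1) \<Leftarrow> n\<close>, where \<open>\<alpha>\<^sub>0\<close> and \<open>\<alpha>\<^sub>n\<close> are the long roots.
\<close>

definition cartan_C :: "nat \<Rightarrow> nat \<Rightarrow> nat \<Rightarrow> int" where
  "cartan_C n i j =
     (if i = j then 2
      else if (i = 1 \<and> j = 0) \<or> (i = n - 1 \<and> j = n) then -2
      else if i = j + 1 \<or> j = i + 1 then -1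
      else 0)"

definition marks_C :: "nat \<Rightarrow> nat \<Rightarrow> nat" where
  "marks_C n i = (if i = 0 \<or> i = n then 1 else 2)"

text \<open>
  Two sanity checks: this is an affine Cartan matrix, and the columns sum to zero, so that the
  canonical central element is \<open>h\<^sub>0 + \<dots> + h\<^sub>n\<close> (which separates \<open>C\<^sub>n\<^sup>(\<^sup>1\<^sup>)\<close> from its
  transpose \<open>D\<^sub>n\<^sub>+\<^sub>1\<^sup>(\<^sup>2\<^sup>)\<close>).
\<close>

lemma sum_restrict_support:
  fixes g :: "nat \<Rightarrow> int"
  assumes "finite S" "\<And>j. j \<in> S - T \<Longrightarrow> g j = 0" "T \<subseteq> S"
  shows "sum g S = sum g T"
  using assms by (intro sum.mono_neutral_right) auto

lemma cartan_C_column_sum: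
  assumes "2 \<le> n" "j \<le> n"
  shows "(\<Sum>i\<le>n. cartan_C n i j) = 0"
proof -
  consider "j = 0" | "j = n" | "0 < j" "j < n" using assms by linarith
  then show ?thesis
  proof cases
    case 1
    have "(\<Sum>i\<le>n. cartan_C n i j) = (\<Sum>i\<in>{0,1}. cartan_C n i j)"
      by (rule sum_restrict_support) (use assms 1 in \<open>auto simp: cartan_C_def\<close>)
    then show ?thesis using assms 1 by (simp add: cartan_C_def)
  next
    case 2
    have "(\<Sum>i\<le>n. cartan_C n i j) = (\<Sum>i\<in>{n-1,n}. cartan_C n i j)"
      by (rule sum_restrict_support) (use assms 2 in \<open>auto simp: cartan_C_def\<close>)
    then show ?thesis using assms 2 by (simp add: cartan_C_def)
  next
    case 3
    have "(\<Sum>i\<le>n. cartan_C n i j) = (\<Sum>i\<in>{j-1,j,j+1}. cartan_C n i j)"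
      by (rule sum_restrict_support) (use assms 3 in \<open>auto simp: cartan_C_def\<close>)
    moreover obtain k where "j = Suc k" using 3 by (cases j) auto
    ultimately show ?thesis using assms 3 by (auto simp: cartan_C_def)
  qed
qed

lemma marks_C_kernel:
  assumes "2 \<le> n" "i \<le> n"
  shows "(\<Sum>j\<le>n. cartan_C n i j * int (marks_C n j)) = 0" (is "sum ?g _ = 0")
proof -
  consider "i = 0" | "i = n" | "0 < i" "i < n" using assms by linarith
  then show ?thesis
  proof cases
    case 1
    have "sum ?g {..n} = sum ?g {0,1}"
      by (rule sum_restrict_support) (use assms 1 in \<open>auto simp: cartan_C_def\<close>)
    then show ?thesis using assms 1 by (simp add: cartan_C_def marks_C_def)
  next
    case 2
    have "sum ?g {..n} = sum ?g {n-1,n}"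
      by (rule sum_restrict_support) (use assms 2 in \<open>auto simp: cartan_C_def\<close>)
    then show ?thesis using assms 2 by (simp add: cartan_C_def marks_C_def)
  next
    case 3
    have "sum ?g {..n} = sum ?g {i-1,i,i+1}"
      by (rule sum_restrict_support) (use assms 3 in \<open>auto simp: cartan_C_def\<close>)
    moreover obtain k where "i = Suc k" using 3 by (cases i) auto
    ultimately show ?thesis using assms 3 by (auto simp: cartan_C_def marks_C_def)
  qed
qed

lemma affine_cartan_matrix_C:
  assumes n: "2 \<le> n"
  shows "affine_cartan_matrix n (cartan_C n) (marks_C n)"
proof
  fix J :: "nat set" assume J: "J \<noteq> {}" "J \<subset> {..n}"
  have "\<exists>k<n. (k \<in> J) \<noteq> (Suc k \<in> J)"
  proof (rule ccontr)
    assume "\<not> ?thesis"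
    then have step: "\<And>k. k < n \<Longrightarrow> (k \<in> J) = (Suc k \<in> J)" by blast
    have "(k \<in> J) = (0 \<in> J)" if "k \<le> n" for k
      using that by (induction k) (use step in auto)
    then show False using J by blast
  qed
  then obtain k where k: "k < n" "(k \<in> J) \<noteq> (Suc k \<in> J)" by blast
  have "cartan_C n k (Suc k) \<noteq> 0" "cartan_C n (Suc k) k \<noteq> 0"
    by (auto simp: cartan_C_def)
  then show "\<exists>i\<in>J. \<exists>j\<in>{..n} - J. cartan_C n i j \<noteq> 0"
    using k J by (cases "k \<in> J") force+
next
  have "Gcd (marks_C n ` {..n}) dvd marks_C n 0" by (rule Gcd_dvd) auto
  then show "Gcd (marks_C n ` {..n}) = 1" by (simp add: marks_C_def)
qed (use n marks_C_kernel in \<open>auto simp: cartan_C_def marks_C_def split: if_splits\<close>)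

section \<open>Affine Kac--Moody algebras\<close>

text \<open>
  The Cartan subalgebra: a complex vector space with basis the simple coroots \<open>h\<^sub>0, \<dots>, h\<^sub>n\<close> and a
  scaling element \<open>d\<close>, together with the simple roots \<open>\<alpha>\<^sub>0, \<dots>, \<alpha>\<^sub>n\<close> in its dual.
\<close>

locale affine_realization =
  affine_cartan_matrix n A a + H: vector_space scaleH
  for n :: nat and A :: "nat \<Rightarrow> nat \<Rightarrow> int" and a :: "nat \<Rightarrow> nat"
    and scaleH :: "complex \<Rightarrow> 'h::ab_group_add \<Rightarrow> 'h" +
  fixes coroot :: "nat \<Rightarrow> 'h" and d :: 'h and alpha :: "nat \<Rightarrow> 'h \<Rightarrow> complex"
  assumes coroot_inj: "inj_on coroot {..n}"
    and d_not_coroot: "d \<notin> coroot ` {..n}"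
    and basis_independent: "\<not> H.dependent (insert d (coroot ` {..n}))"
    and basis_span: "H.span (insert d (coroot ` {..n})) = UNIV"
    and alpha_linear: "j \<le> n \<Longrightarrow> Vector_Spaces.linear scaleH (*) (alpha j)"
    and alpha_coroot: "\<lbrakk>i \<le> n; j \<le> n\<rbrakk> \<Longrightarrow> alpha j (coroot i) = of_int (A i j)"
    and alpha_d: "j \<le> n \<Longrightarrow> alpha j d = (if j = 0 then 1 else 0)"
begin

text \<open>
  \<open>\<Lambda>\<^sub>i\<close> is the element of the dual basis belonging to \<open>h\<^sub>i\<close>:
  \<open>\<Lambda>\<^sub>i(h\<^sub>j) = \<delta>\<^sub>i\<^sub>j\<close> and \<open>\<Lambda>\<^sub>i(d) = 0\<close>.
\<close>

definition fundamental_weight :: "nat \<Rightarrow> 'h \<Rightarrow> complex" where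
  "fundamental_weight i = (\<lambda>x. H.representation (insert d (coroot ` {..n})) x (coroot i))"

definition null_root :: "'h \<Rightarrow> complex" where
  "null_root = (\<lambda>x. \<Sum>i\<le>n. of_nat (a i) * alpha i x)"

definition dominant_integral :: "('h \<Rightarrow> complex) \<Rightarrow> bool" where
  "dominant_integral \<mu> \<longleftrightarrow>
     Vector_Spaces.linear scaleH (*) \<mu> \<and> (\<forall>i\<le>n. \<mu> (coroot i) \<in> \<nat>)"

end

locale complex_lie_algebra = G: vector_space scaleG
  for scaleG :: "complex \<Rightarrow> 'g::ab_group_add \<Rightarrow> 'g" +
  fixes bracket :: "'g \<Rightarrow> 'g \<Rightarrow> 'g"
  assumes bracket_linear_right: "Vector_Spaces.linear scaleG scaleG (\<lambda>y. bracket x y)"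
    and bracket_linear_left: "Vector_Spaces.linear scaleG scaleG (\<lambda>x. bracket x y)"
    and bracket_self: "bracket x x = 0"
    and jacobi: "bracket x (bracket y z) + bracket y (bracket z x) + bracket z (bracket x y) = 0"
begin

definition lie_subalgebra :: "'g set \<Rightarrow> bool" where
  "lie_subalgebra S \<longleftrightarrow> G.subspace S \<and> (\<forall>x\<in>S. \<forall>y\<in>S. bracket x y \<in> S)"

definition lie_ideal :: "'g set \<Rightarrow> bool" where
  "lie_ideal J \<longleftrightarrow> G.subspace J \<and> (\<forall>x. \<forall>y\<in>J. bracket x y \<in> J)"

end

text \<open>
  The affine Kac--Moody algebra in Kac's sense: \<open>cartan\<close> embeds the Cartan subalgebra, the Chevalley
  generators satisfy the standard relations and generate together with the Cartan subalgebra, and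
  no nonzero ideal meets the Cartan subalgebra trivially. These conditions determine the algebra up
  to isomorphism; the last one replaces (and implies) the Serre relations.
\<close>

locale affine_kac_moody_algebra =
  affine_realization n A a scaleH coroot d alpha +
  complex_lie_algebra scaleG bracket
  for n :: nat and A :: "nat \<Rightarrow> nat \<Rightarrow> int" and a :: "nat \<Rightarrow> nat"
    and scaleH :: "complex \<Rightarrow> 'h::ab_group_add \<Rightarrow> 'h"
    and coroot :: "nat \<Rightarrow> 'h" and d :: 'h and alpha :: "nat \<Rightarrow> 'h \<Rightarrow> complex"
    and scaleG :: "complex \<Rightarrow> 'g::ab_group_add \<Rightarrow> 'g" and bracket :: "'g \<Rightarrow> 'g \<Rightarrow> 'g" +
  fixes cartan :: "'h \<Rightarrow> 'g" and e f :: "nat \<Rightarrow> 'g"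
  assumes cartan_linear: "Vector_Spaces.linear scaleH scaleG cartan"
    and cartan_inj: "inj cartan"
    and cartan_abelian: "bracket (cartan x) (cartan y) = 0"
    and bracket_e_f: "\<lbrakk>i \<le> n; j \<le> n\<rbrakk> \<Longrightarrow>
      bracket (e i) (f j) = (if i = j then cartan (coroot i) else 0)"
    and bracket_cartan_e: "i \<le> n \<Longrightarrow> bracket (cartan x) (e i) = scaleG (alpha i x) (e i)"
    and bracket_cartan_f: "i \<le> n \<Longrightarrow> bracket (cartan x) (f i) = scaleG (- alpha i x) (f i)"
    and generates: "\<lbrakk>lie_subalgebra S; range cartan \<subseteq> S; e ` {..n} \<subseteq> S; f ` {..n} \<subseteq> S\<rbrakk>
      \<Longrightarrow> S = UNIV"
    and ideal_trivial: "\<lbrakk>lie_ideal J; J \<inter> range cartan = {0}\<rbrakk> \<Longrightarrow> J = {0}"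

section \<open>Modules, weights and maximal dominant weights\<close>

locale affine_kac_moody_module =
  affine_kac_moody_algebra n A a scaleH coroot d alpha scaleG bracket cartan e f +
  V: vector_space scaleV
  for n :: nat and A :: "nat \<Rightarrow> nat \<Rightarrow> int" and a :: "nat \<Rightarrow> nat"
    and scaleH :: "complex \<Rightarrow> 'h::ab_group_add \<Rightarrow> 'h"
    and coroot :: "nat \<Rightarrow> 'h" and d :: 'h and alpha :: "nat \<Rightarrow> 'h \<Rightarrow> complex"
    and scaleG :: "complex \<Rightarrow> 'g::ab_group_add \<Rightarrow> 'g" and bracket :: "'g \<Rightarrow> 'g \<Rightarrow> 'g"
    and cartan :: "'h \<Rightarrow> 'g" and e f :: "nat \<Rightarrow> 'g"
    and scaleV :: "complex \<Rightarrow> 'v::ab_group_add \<Rightarrow> 'v" +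
  fixes act :: "'g \<Rightarrow> 'v \<Rightarrow> 'v"
  assumes act_linear_right: "Vector_Spaces.linear scaleV scaleV (\<lambda>v. act x v)"
    and act_linear_left: "Vector_Spaces.linear scaleG scaleV (\<lambda>x. act x v)"
    and act_bracket: "act (bracket x y) v = act x (act y v) - act y (act x v)"
begin

definition submodule :: "'v set \<Rightarrow> bool" where
  "submodule W \<longleftrightarrow> V.subspace W \<and> (\<forall>x. \<forall>w\<in>W. act x w \<in> W)"

definition irreducible_module :: bool where
  "irreducible_module \<longleftrightarrow>
     (UNIV :: 'v set) \<noteq> {0} \<and> (\<forall>W. submodule W \<longrightarrow> W = {0} \<or> W = UNIV)"

definition weight_space :: "('h \<Rightarrow> complex) \<Rightarrow> 'v set" where
  "weight_space \<mu> = {v. \<forall>x. act (cartan x) v = scaleV (\<mu> x) v}"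

text \<open>The \<open>e\<^sub>i\<close> generate the positive part, so killing them means being killed by all of it.\<close>

definition highest_weight_module :: "('h \<Rightarrow> complex) \<Rightarrow> bool" where
  "highest_weight_module \<Lambda> \<longleftrightarrow>
     (\<exists>v. v \<noteq> 0 \<and> v \<in> weight_space \<Lambda> \<and> (\<forall>i\<le>n. act (e i) v = 0) \<and>
        (\<forall>W. submodule W \<and> v \<in> W \<longrightarrow> W = UNIV))"

text \<open>
  The module is (a copy of) \<open>V(\<Lambda>)\<close>, which is unique up to isomorphism; in particular its
  weights depend on \<open>\<Lambda>\<close> only.
\<close>

definition is_V :: "('h \<Rightarrow> complex) \<Rightarrow> bool" where
  "is_V \<Lambda> \<longleftrightarrow> highest_weight_module \<Lambda> \<and> irreducible_module"

definition weights :: "('h \<Rightarrow> complex) set" where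
  "weights = {\<mu>. Vector_Spaces.linear scaleH (*) \<mu> \<and> weight_space \<mu> \<noteq> {0}}"

definition maximal_weights :: "('h \<Rightarrow> complex) set" where
  "maximal_weights = {\<mu> \<in> weights. (\<lambda>x. \<mu> x + null_root x) \<notin> weights}"

definition max_dominant_weights :: "('h \<Rightarrow> complex) set" where
  "max_dominant_weights = {\<mu> \<in> maximal_weights. dominant_integral \<mu>}"

end

section \<open>The two triangular arrays\<close>

definition odd_term :: "nat \<Rightarrow> nat \<Rightarrow> int" where
  "odd_term n l =
     (if odd n \<and> odd l then int (((n + l) div 2 - 1) choose ((l - 1) div 2)) else 0)"

text \<open>Integer-valued, so that the subtraction is the true one; nonnegativity is proved below.\<close>

fun T0 :: "nat \<Rightarrow> nat \<Rightarrow> int" where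
  "T0 n 0 = 1"
| "T0 0 (Suc l) = 1"
| "T0 (Suc n) (Suc l) = T0 (Suc n) l + T0 n (Suc l) - odd_term (Suc n) (Suc l)"

fun T1 :: "nat \<Rightarrow> nat \<Rightarrow> int" where
  "T1 n 0 = 0"
| "T1 0 (Suc l) = 0"
| "T1 (Suc n) (Suc l) = T1 (Suc n) l + T1 n (Suc l) + odd_term (Suc n) (Suc l)"

lemma T1_nonneg: "T1 n l \<ge> 0"
  by (induction n l rule: T1.induct) (auto simp: odd_term_def)

lemma T0_minus_T1:
  "T0 n l - T1 n l = (if odd n \<and> odd l then 0 else int ((n div 2 + l div 2) choose (n div 2)))"
proof (induction n l rule: T0.induct)
  case (3 n l)
  have IH: "T0 (Suc n) (Suc l) - T1 (Suc n) (Suc l) =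
      (T0 (Suc n) l - T1 (Suc n) l) + (T0 n (Suc l) - T1 n (Suc l)) - 2 * odd_term (Suc n) (Suc l)"
    by simp
  show ?case
  proof (cases "even n"; cases "even l")
    assume ev: "even n" "even l"
    then obtain p q where "n = 2 * p" "l = 2 * q" by (auto elim!: evenE)
    moreover have "(p + q) choose p = (p + q) choose q"
      using binomial_symmetric[of p "p + q"] by simp
    ultimately show ?thesis unfolding IH 3 by (simp add: odd_term_def)
  next
    assume "even n" "odd l"
    then obtain p q where "n = 2 * p" "l = 2 * q + 1" by (auto elim!: evenE oddE)
    then show ?thesis unfolding IH 3 by (simp add: odd_term_def)
  next
    assume "odd n" "even l"
    then obtain p q where "n = 2 * p + 1" "l = 2 * q" by (auto elim!: evenE oddE)
    then show ?thesis unfolding IH 3 by (simp add: odd_term_def)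
  next
    assume "odd n" "odd l"
    then obtain p q where "n = 2 * p + 1" "l = 2 * q + 1" by (auto elim!: evenE oddE)
    then show ?thesis unfolding IH 3 by (simp add: odd_term_def)
  qed
qed auto

lemma T0_nonneg: "T0 n l \<ge> 0"
  using T0_minus_T1[of n l] T1_nonneg[of n l] by (auto split: if_splits)

end

(* In positive level every dominant weight in Lambda - Q_+ is a weight of V(Lambda) (Kac, Prop. 11.2).
   Hence each dominant class of Lambda + Q modulo the null root contains exactly one maximal weight,
   and the values m_i on the simple coroots identify max^+ with the tuples of naturals (m_0, ..., m_n)
   of sum l whose parity of sum i m_i is that of Lambda: for C_n^(1) the image of the Cartan matrix
   is cut out by sum c_i = 0 and sum i c_i even. Splitting the tuples by whether m_n = 0 gives
   the recursion, the odd term being T_0 - T_1. In level 0 the module is trivial. *)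

theory Submission
  imports Defs
begin

section \<open>Compositions with prescribed parity\<close>

text \<open>That dominant elements below \<Lambda> are weights is shown by descent. A nonzero vector
  whose weight is a positive integer on h_i is not killed by f_i, so from \<Lambda> one can keep
  subtracting simple roots towards the target. The descent stalls short of it only if the remaining
  difference is a multiple of the null root and the target vanishes on every simple coroot. This is
  why level 0 is separate: there the negative multiples of the null root are dominant without being
  weights of the trivial module. The parity condition comes from the columns of the Cartan matrix:
  weighting row i by i gives the column sums -2, 0, ..., 0, 2. Conversely, double summation inverts
  the matrix, and the parity is exactly what makes the last coordinate of the solution an integer.
  In the count, lowering m_n by one changes the weighted sum by n, which exchanges the two parities
  when n is odd; both counts are therefore obtained in one induction.\<close>

text \<open>Tuples are functions vanishing beyond \<open>n\<close>, so that equality of functions is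
  equality of tuples. The target \<open>p\<close> is left unreduced to absorb shifts by
  addition.\<close>

definition parity_compositions :: "nat \<Rightarrow> nat \<Rightarrow> nat \<Rightarrow> (nat \<Rightarrow> nat) set" where
  "parity_compositions n l p =
     {m. (\<forall>i>n. m i = 0) \<and> (\<Sum>i\<le>n. m i) = l \<and> (\<Sum>i\<le>n. i * m i) mod 2 = p mod 2}"

lemma parity_compositions_sum_0:
  "parity_compositions n 0 p = (if even p then {\<lambda>_. 0} else {})"
proof -
  have "m = (\<lambda>_. 0)" if "\<forall>i>n. m i = 0" "\<forall>i\<le>n. m i = 0" for m :: "nat \<Rightarrow> nat"
    using that by (metis linorder_not_le ext)
  then show ?thesis
    by (auto simp: parity_compositions_def mod2_eq_if)
qed

lemma parity_compositions_one_part: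
  "parity_compositions 0 l p = (if even p then {(\<lambda>_. 0)(0 := l)} else {})"
  by (auto simp: parity_compositions_def mod2_eq_if fun_eq_iff)

text \<open>Taking one unit off the last entry subtracts \<open>a\<close> from the weighted sum;
  modulo 2 this amounts to adding \<open>a\<close> to the target, which avoids subtraction on the
  naturals.\<close>

lemma mod2_mult_Suc:
  "(s + a * Suc k) mod 2 = p mod 2 \<longleftrightarrow> (s + a * k) mod 2 = (p + a) mod (2 :: nat)"
  unfolding mult_Suc_right mod2_eq_if by auto

lemma upd_last_mem_parity_compositions:
  "m(Suc n := k) \<in> parity_compositions (Suc n) l p \<longleftrightarrow>
     (\<forall>i>Suc n. m i = 0) \<and> (\<Sum>i\<le>n. m i) + k = l \<and>
     ((\<Sum>i\<le>n. i * m i) + Suc n * k) mod 2 = p mod 2"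
proof -
  have "(\<Sum>i\<le>n. (m(Suc n := k)) i) = (\<Sum>i\<le>n. m i)"
    "(\<Sum>i\<le>n. i * (m(Suc n := k)) i) = (\<Sum>i\<le>n. i * m i)"
    by (auto intro!: sum.cong)
  moreover have "(\<forall>i>Suc n. (m(Suc n := k)) i = 0) \<longleftrightarrow> (\<forall>i>Suc n. m i = 0)" by auto
  ultimately show ?thesis
    unfolding parity_compositions_def mem_Collect_eq sum.atMost_Suc by (simp only: fun_upd_same)
qed

lemma Suc_last_mem_parity_compositions:
  "m(Suc n := Suc k) \<in> parity_compositions (Suc n) (Suc l) p \<longleftrightarrow>
     m(Suc n := k) \<in> parity_compositions (Suc n) l (p + Suc n)"
  unfolding upd_last_mem_parity_compositions mod2_mult_Suc add_Suc_right nat.inject ..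

lemma parity_compositions_Suc_Suc:
  "parity_compositions (Suc n) (Suc l) p =
     parity_compositions n (Suc l) p \<union>
     (\<lambda>m. m(Suc n := Suc (m (Suc n)))) ` parity_compositions (Suc n) l (p + Suc n)"
  (is "?C = ?A \<union> ?g ` ?B")
proof (intro set_eqI iffI)
  fix m assume m: "m \<in> ?C"
  show "m \<in> ?A \<union> ?g ` ?B"
  proof (cases "m (Suc n)")
    case 0
    then have "m i = 0" if "i > n" for i
      using m that by (cases "i = Suc n") (auto simp: parity_compositions_def)
    then show ?thesis using m 0 by (auto simp: parity_compositions_def)
  next
    case (Suc k)
    let ?m = "m(Suc n := k)"
    have "m = m(Suc n := Suc k)" using Suc by auto
    then have "?m \<in> ?B" using m Suc_last_mem_parity_compositions by metis
    moreover have "?g ?m = m" using Suc by auto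
    ultimately show ?thesis by (intro UnI2 image_eqI[of _ _ ?m]) simp_all
  qed
next
  fix m assume "m \<in> ?A \<union> ?g ` ?B"
  then show "m \<in> ?C"
  proof
    assume "m \<in> ?A" then show ?thesis by (auto simp: parity_compositions_def)
  next
    assume "m \<in> ?g ` ?B"
    then obtain k where k: "k \<in> ?B" "m = ?g k" by blast
    then show ?thesis by (simp only: Suc_last_mem_parity_compositions fun_upd_triv)
  qed
qed

lemma finite_parity_compositions: "finite (parity_compositions n l p)"
proof (induction n l arbitrary: p rule: T0.induct)
  case (3 n l)
  then show ?case by (simp add: parity_compositions_Suc_Suc)
qed (auto simp: parity_compositions_sum_0 parity_compositions_one_part)

lemma card_parity_compositions_Suc_Suc:
  "card (parity_compositions (Suc n) (Suc l) p) =
     card (parity_compositions n (Suc l) p) + card (parity_compositions (Suc n) l (p + Suc n))"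
proof -
  let ?g = "\<lambda>m :: nat \<Rightarrow> nat. m(Suc n := Suc (m (Suc n)))"
  have "inj ?g" by (auto simp: inj_def fun_eq_iff split: if_splits)
  then have "card (?g ` X) = card X" for X by (meson card_image inj_on_subset subset_UNIV)
  moreover have "parity_compositions n (Suc l) p \<inter> ?g ` parity_compositions (Suc n) l (p + Suc n) = {}"
    by (auto simp: parity_compositions_def)
  ultimately show ?thesis
    by (simp add: parity_compositions_Suc_Suc card_Un_disjoint finite_parity_compositions)
qed

text \<open>Identifies the correction term of the recursion: for \<open>n = 2 * p\<close> and
  \<open>l = 2 * q\<close> the closed form gives \<open>(p + q) choose p\<close> and the correction
  is \<open>(p + q) choose q\<close>; for odd \<open>l\<close> both sides vanish.\<close>

lemma T0_minus_T1_odd: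
  assumes "even n"
  shows "T0 (Suc n) l - T1 (Suc n) l = odd_term (Suc n) (Suc l)"
proof (cases "even l")
  case True
  then obtain p q where "n = 2 * p" "l = 2 * q" using assms by (auto elim!: evenE)
  moreover have "(p + q) choose p = (p + q) choose q"
    using binomial_symmetric[of p "p + q"] by simp
  ultimately show ?thesis unfolding T0_minus_T1 by (simp add: odd_term_def)
qed (use assms in \<open>simp add: T0_minus_T1 odd_term_def\<close>)

text \<open>For even \<open>n\<close> the shift by \<open>Suc n\<close> flips the parity, so the
  recursion mixes the arrays, as in \<open>T0 n (Suc l) + T1 (Suc n) l\<close>; trading
  \<open>T1\<close> for \<open>T0\<close> there, or conversely, costs exactly the odd term. For odd
  \<open>n\<close> the parity is kept and the odd term is zero.\<close>

lemma card_parity_compositions: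
  "int (card (parity_compositions n l p)) = (if even p then T0 n l else T1 n l)"
proof (induction n l arbitrary: p rule: T0.induct)
  case (3 n l)
  show ?case
  proof (cases "even n")
    case True
    then show ?thesis
      using 3 T0_minus_T1_odd[OF True, of l] by (simp add: card_parity_compositions_Suc_Suc)
  next
    case False
    then show ?thesis
      using 3 by (simp add: card_parity_compositions_Suc_Suc odd_term_def)
  qed
qed (auto simp: parity_compositions_sum_0 parity_compositions_one_part)

section \<open>Root combinations\<close>

text \<open>At an index where \<open>z j / a j\<close> is maximal, \<open>A a = 0\<close> writes \<open>(A z) i\<close> as a sum of
  nonnegative terms, so that the maximum propagates to all neighbours.\<close>

lemma (in affine_cartan_matrix) nonpos_image_proportional:
  fixes z :: "nat \<Rightarrow> int"
  assumes nonpos: "\<And>i. i \<le> n \<Longrightarrow> (\<Sum>j\<le>n. A i j * z j) \<le> 0" and ij: "i \<le> n" "j \<le> n"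
  shows "z i * int (a j) = z j * int (a i)"
proof -
  define r where "r k = real_of_int (z k) / real (a k)" for k
  define M where "M = Max (r ` {..n})"
  define J where "J = {k \<in> {..n}. r k = M}"
  have le: "r k \<le> M" if "k \<le> n" for k using that unfolding M_def by simp
  have za: "real_of_int (z k) = r k * real (a k)" if "k \<le> n" for k
    using marks_pos[OF that] by (simp add: r_def)
  have "M \<in> r ` {..n}" unfolding M_def by (intro Max_in) auto
  then have "J \<noteq> {}" unfolding J_def by auto
  have "J = {..n}"
  proof (rule ccontr)
    assume "J \<noteq> {..n}"
    then have "J \<subset> {..n}" unfolding J_def by blast
    then obtain k l where kl: "k \<in> J" "l \<in> {..n} - J" "A k l \<noteq> 0"
      using indecomposable \<open>J \<noteq> {}\<close> by meson
    have k: "k \<le> n" "r k = M" using kl by (auto simp: J_def)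
    have l: "l \<le> n" "l \<noteq> k" "r l < M" using kl le by (force simp: J_def)+
    let ?t = "\<lambda>j. real_of_int (A k j) * (real (a j) * (r j - M))"
    have "sum ?t {..n} = real_of_int (\<Sum>j\<le>n. A k j * z j) - M * real_of_int (\<Sum>j\<le>n. A k j * int (a j))"
      by (simp add: sum_distrib_left za algebra_simps flip: sum_subtractf)
    also have "\<dots> \<le> 0" using nonpos[OF k(1)] marks_kernel[OF k(1)]
      by (simp only: of_int_le_0_iff of_int_0 mult_zero_right diff_zero)
    finally have "sum ?t {..n} \<le> 0" .
    moreover have "sum ?t {..n} > 0"
    proof (rule sum_pos2[of _ l])
      have "A k l < 0" using off_diag[OF k(1) l(1)] l kl by force
      then show "?t l > 0" using l marks_pos[OF l(1)]
        by (intro mult_neg_neg) (auto intro: mult_pos_neg)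
      show "?t j \<ge> 0" if "j \<in> {..n}" for j
      proof (cases "j = k")
        case False
        then show ?thesis using off_diag[of k j] that k le[of j]
          by (intro mult_nonpos_nonpos) (auto intro: mult_nonneg_nonpos)
      qed (use k in simp)
    qed (use l in auto)
    ultimately show False by simp
  qed
  then have "r i = r j" using ij unfolding J_def
    by (metis (mono_tags, lifting) atMost_iff mem_Collect_eq)
  then have "real_of_int (z i * int (a j)) = real_of_int (z j * int (a i))"
    using za ij by simp
  then show ?thesis by (simp only: of_int_eq_iff)
qed

context affine_realization
begin

text \<open>The coefficients are natural numbers, so \<open>range (lower \<Lambda>)\<close> is
  \<Lambda> - Q_+. Values of \<open>b\<close> beyond \<open>n\<close> are ignored, hence vectors
  \<open>b\<close> are compared only up to \<open>n\<close>.\<close>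

definition lower :: "('h \<Rightarrow> complex) \<Rightarrow> (nat \<Rightarrow> nat) \<Rightarrow> 'h \<Rightarrow> complex" where
  "lower \<Lambda> b = (\<lambda>x. \<Lambda> x - (\<Sum>j\<le>n. of_nat (b j) * alpha j x))"

lemma root_combination_coroot:
  "i \<le> n \<Longrightarrow> (\<Sum>j\<le>n. of_int (z j) * alpha j (coroot i)) = of_int (\<Sum>j\<le>n. A i j * z j)"
  by (simp add: alpha_coroot mult.commute)

lemma root_combination_d: "(\<Sum>j\<le>n. of_int (z j) * alpha j d) = of_int (z 0)"
proof -
  have "(\<Sum>j\<le>n. of_int (z j) * alpha j d) = (\<Sum>j\<le>n. if j = 0 then of_int (z j) else 0)"
    by (intro sum.cong) (auto simp: alpha_d)
  then show ?thesis by simp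
qed

text \<open>The simple coroots determine \<open>z\<close> only up to a multiple of the marks, the
  Cartan matrix being singular. The scaling element reads off \<open>z 0\<close> and removes this
  ambiguity.\<close>

lemma root_combination_eq_0:
  fixes z :: "nat \<Rightarrow> int"
  assumes "\<And>x. (\<Sum>j\<le>n. of_int (z j) * alpha j x) = 0" and "i \<le> n"
  shows "z i = 0"
proof -
  have "(\<Sum>j\<le>n. A k j * z j) = 0" if "k \<le> n" for k
    using assms(1)[of "coroot k"] root_combination_coroot[OF that, of z] by (metis of_int_eq_0_iff)
  then have "z i * int (a 0) = z 0 * int (a i)"
    using assms(2) by (intro nonpos_image_proportional) auto
  moreover have "z 0 = 0" using assms(1)[of d] root_combination_d[of z] by simp
  ultimately show ?thesis using marks_pos[of 0] by simp
qed

lemma lower_coroot: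
  assumes "i \<le> n" "\<Lambda> (coroot i) = of_nat (L i)"
  shows "lower \<Lambda> b (coroot i) = of_int (int (L i) - (\<Sum>j\<le>n. A i j * int (b j)))"
  using root_combination_coroot[OF assms(1), of "\<lambda>j. int (b j)"] assms(2) by (simp add: lower_def)

lemma lower_cong: "(\<And>i. i \<le> n \<Longrightarrow> b i = b' i) \<Longrightarrow> lower \<Lambda> b = lower \<Lambda> b'"
  by (simp add: lower_def)

lemma lower_eqD:
  assumes "lower \<Lambda> b = lower \<Lambda> b'" "i \<le> n"
  shows "b i = b' i"
proof -
  have "int (b i) - int (b' i) = 0"
  proof (rule root_combination_eq_0[OF _ assms(2)])
    fix x show "(\<Sum>j\<le>n. of_int (int (b j) - int (b' j)) * alpha j x) = 0"
      using fun_cong[OF assms(1), of x] by (simp add: lower_def algebra_simps sum_subtractf)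
  qed
  then show ?thesis by simp
qed

lemma linear_functional_iff:
  "Vector_Spaces.linear scaleH (*) g \<longleftrightarrow>
     (\<forall>x y. g (x + y) = g x + g y) \<and> (\<forall>c x. g (scaleH c x) = c * g x)"
proof -
  have "vector_space ((*) :: complex \<Rightarrow> complex \<Rightarrow> complex)"
    by standard (simp_all add: algebra_simps)
  then show ?thesis using H.vector_space_axioms by (simp add: Vector_Spaces.linear_iff)
qed

lemma linear_lower:
  assumes "Vector_Spaces.linear scaleH (*) \<Lambda>"
  shows "Vector_Spaces.linear scaleH (*) (lower \<Lambda> b)"
  using assms alpha_linear unfolding linear_functional_iff lower_def
  by (simp add: algebra_simps sum.distrib sum_distrib_left)

lemma linear_fundamental_weight: "Vector_Spaces.linear scaleH (*) (fundamental_weight i)"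
  unfolding linear_functional_iff fundamental_weight_def
  by (simp add: H.representation_add H.representation_scale basis_independent basis_span)

lemma fundamental_weight_coroot:
  "\<lbrakk>i \<le> n; j \<le> n\<rbrakk> \<Longrightarrow> fundamental_weight i (coroot j) = (if i = j then 1 else 0)"
  using coroot_inj unfolding fundamental_weight_def
  by (subst H.representation_basis[OF basis_independent]) (auto dest: inj_onD)

lemma lower_add:
  assumes "i \<le> n"
  shows "lower \<Lambda> (b(i := b i + k)) = (\<lambda>x. lower \<Lambda> b x - of_nat k * alpha i x)"
proof
  fix x
  have "(\<Sum>j\<le>n. of_nat ((b(i := b i + k)) j) * alpha j x) =
      (\<Sum>j\<le>n. of_nat (b j) * alpha j x + (if j = i then of_nat k * alpha i x else 0))"
    by (intro sum.cong) (auto simp: algebra_simps)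
  then show "lower \<Lambda> (b(i := b i + k)) x = lower \<Lambda> b x - of_nat k * alpha i x"
    using assms by (simp add: lower_def sum.distrib)
qed

lemma lower_zero [simp]: "lower \<Lambda> (\<lambda>_. 0) = \<Lambda>"
  by (simp add: lower_def)

lemma lower_lower: "lower (lower \<Lambda> b) b' = lower \<Lambda> (\<lambda>i. b i + b' i)"
  by (simp add: lower_def fun_eq_iff sum.distrib algebra_simps)

lemma lower_plus_null_root: "lower \<Lambda> (\<lambda>i. b i + a i) = (\<lambda>x. lower \<Lambda> b x - null_root x)"
  by (simp add: lower_def null_root_def fun_eq_iff sum.distrib algebra_simps)

lemma dominant_integral_lower_iff:
  assumes "Vector_Spaces.linear scaleH (*) \<Lambda>" "\<And>i. i \<le> n \<Longrightarrow> \<Lambda> (coroot i) = of_nat (L i)"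
  shows "dominant_integral (lower \<Lambda> b) \<longleftrightarrow> (\<forall>i\<le>n. (\<Sum>j\<le>n. A i j * int (b j)) \<le> int (L i))"
proof -
  have "(of_int z :: complex) \<in> \<nat> \<longleftrightarrow> 0 \<le> z" for z :: int
  proof
    assume "(of_int z :: complex) \<in> \<nat>"
    then obtain k where "(of_int z :: complex) = of_int (int k)" by (auto elim!: Nats_cases)
    then show "0 \<le> z" by (simp only: of_int_eq_iff)
  next
    assume "0 \<le> z"
    then show "(of_int z :: complex) \<in> \<nat>" by (metis of_nat_in_Nats of_int_of_nat_eq zero_le_imp_eq_int)
  qed
  then show ?thesis
    using linear_lower[OF assms(1)] lower_coroot[of _ \<Lambda> L, OF _ assms(2)]
    by (auto simp del: of_int_diff of_int_sum of_int_mult simp: dominant_integral_def)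
qed

end

section \<open>Weights of highest weight modules\<close>

context affine_kac_moody_module
begin

lemma act_add: "act x (u + v) = act x u + act x v"
  and act_scale: "act x (scaleV c v) = scaleV c (act x v)"
  using act_linear_right[of x] by (simp_all add: Vector_Spaces.linear_iff)

lemma act_add_left: "act (x + y) v = act x v + act y v"
  and act_scale_left: "act (scaleG c x) v = scaleV c (act x v)"
  using act_linear_left[of v] by (simp_all add: Vector_Spaces.linear_iff)

lemma act_zero [simp]: "act x 0 = 0" using act_scale[of x 0 0] by simp

lemma act_zero_left [simp]: "act 0 v = 0" using act_scale_left[of 0 0 v] by simp

lemma act_minus [simp]: "act x (- v) = - act x v" using act_scale[of x "-1" v] by simp

lemma act_minus_left [simp]: "act (- x) v = - act x v" using act_scale_left[of "-1" x v] by simp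

lemma act_sum: "act x (\<Sum>i\<in>I. u i) = (\<Sum>i\<in>I. act x (u i))"
  by (induction I rule: infinite_finite_induct) (simp_all add: act_add)

lemma act_commute: "act x (act y v) = act y (act x v) + act (bracket x y) v"
  by (simp add: act_bracket)

lemma subspace_weight_space: "V.subspace (weight_space \<mu>)"
  by (simp add: V.subspace_def weight_space_def act_add act_scale V.scale_right_distrib V.scale_left_commute)

lemma act_f_weight_space:
  assumes "u \<in> weight_space \<mu>" "i \<le> n"
  shows "act (f i) u \<in> weight_space (\<lambda>x. \<mu> x - alpha i x)"
  using assms by (simp add: weight_space_def act_commute[of "cartan _"] bracket_cartan_f
      act_scale_left act_scale V.scale_left_diff_distrib)

lemma act_f_weight_space_lower:
  assumes "u \<in> weight_space (lower \<mu> b)" "i \<le> n"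
  shows "act (f i) u \<in> weight_space (lower \<mu> (b(i := b i + 1)))"
  using act_f_weight_space[OF assms] unfolding lower_add[OF assms(2)] by simp

lemma act_e_weight_space:
  assumes "u \<in> weight_space \<mu>" "i \<le> n"
  shows "act (e i) u \<in> weight_space (\<lambda>x. \<mu> x + alpha i x)"
  using assms by (simp add: weight_space_def act_commute[of "cartan _"] bracket_cartan_e
      act_scale_left act_scale V.scale_left_distrib)

section \<open>Independence of weight spaces\<close>

text \<open>Applying \<open>cartan x\<close> minus the scalar \<open>\<nu> x\<close> to a relation
  removes the summand at \<nu> and multiplies the others by \<open>\<mu> x - \<nu> x\<close>, which
  is nonzero for some \<open>x\<close> since \<mu> and \<nu> differ as functions.\<close>

lemma weight_spaces_independent:
  assumes "finite F" "\<And>\<mu>. \<mu> \<in> F \<Longrightarrow> u \<mu> \<in> weight_space \<mu>" "(\<Sum>\<mu>\<in>F. u \<mu>) = 0"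
  shows "\<forall>\<mu>\<in>F. u \<mu> = 0"
  using assms
proof (induction F arbitrary: u rule: finite_induct)
  case (insert \<nu> F)
  have rest: "(\<Sum>\<mu>\<in>F. u \<mu>) = - u \<nu>"
    using insert.prems(2) insert.hyps by (simp add: eq_neg_iff_add_eq_0 add.commute)
  have shift: "\<forall>\<mu>\<in>F. scaleV (\<mu> x - \<nu> x) (u \<mu>) = 0" for x
  proof (rule insert.IH)
    show "scaleV (\<mu> x - \<nu> x) (u \<mu>) \<in> weight_space \<mu>" if "\<mu> \<in> F" for \<mu>
      using insert.prems(1) that subspace_weight_space V.subspace_scale by blast
    have "(\<Sum>\<mu>\<in>F. scaleV (\<mu> x - \<nu> x) (u \<mu>)) = (\<Sum>\<mu>\<in>F. act (cartan x) (u \<mu>) - scaleV (\<nu> x) (u \<mu>))"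
      using insert.prems(1)
      by (intro sum.cong) (auto simp: weight_space_def V.scale_left_diff_distrib)
    also have "\<dots> = act (cartan x) (- u \<nu>) - scaleV (\<nu> x) (- u \<nu>)"
      by (simp add: sum_subtractf act_sum[symmetric] V.scale_sum_right[symmetric] rest)
    also have "\<dots> = 0"
      using insert.prems(1)[of \<nu>] act_scale[of "cartan x" "-1" "u \<nu>"]
      by (simp add: weight_space_def)
    finally show "(\<Sum>\<mu>\<in>F. scaleV (\<mu> x - \<nu> x) (u \<mu>)) = 0" .
  qed
  have "u \<mu> = 0" if \<mu>: "\<mu> \<in> F" for \<mu>
  proof -
    have "\<mu> \<noteq> \<nu>" using \<mu> insert.hyps by blast
    then obtain x where "\<mu> x - \<nu> x \<noteq> 0" by force
    then show ?thesis using shift \<mu> V.scale_eq_0_iff by blast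
  qed
  then show ?case using rest by simp
qed simp

lemma span_weight_spacesE:
  assumes "x \<in> V.span (\<Union>\<mu>\<in>X. weight_space \<mu>)"
  obtains F u where "finite F" "F \<subseteq> X" "\<And>\<mu>. \<mu> \<in> F \<Longrightarrow> u \<mu> \<in> weight_space \<mu>" "x = (\<Sum>\<mu>\<in>F. u \<mu>)"
proof -
  have "\<exists>F u. finite F \<and> F \<subseteq> X \<and> (\<forall>\<mu>\<in>F. u \<mu> \<in> weight_space \<mu>) \<and> x = (\<Sum>\<mu>\<in>F. u \<mu>)"
    using assms
  proof (induction rule: V.span_induct_alt)
    case base
    show ?case by (rule exI[of _ "{}"]) simp
  next
    case (step c x y)
    then obtain \<nu> F u where \<nu>: "\<nu> \<in> X" "x \<in> weight_space \<nu>"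
      and F: "finite F" "F \<subseteq> X" "\<forall>\<mu>\<in>F. u \<mu> \<in> weight_space \<mu>" "y = (\<Sum>\<mu>\<in>F. u \<mu>)"
      by auto
    \<comment> \<open>If \<nu> already occurs in \<open>F\<close>, the new vector is merged with the
      old one, so that each weight keeps a single summand.\<close>
    let ?u = "u(\<nu> := scaleV c x + (if \<nu> \<in> F then u \<nu> else 0))"
    have "y = (if \<nu> \<in> F then u \<nu> else 0) + (\<Sum>\<mu>\<in>F - {\<nu>}. u \<mu>)"
      using F by (simp add: sum.remove)
    then have "scaleV c x + y = (\<Sum>\<mu>\<in>insert \<nu> F. ?u \<mu>)"
      using F by (simp add: sum.insert_remove add.assoc)
    moreover have "\<forall>\<mu>\<in>insert \<nu> F. ?u \<mu> \<in> weight_space \<mu>"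
      using \<nu> F subspace_weight_space by (auto intro!: V.subspace_add V.subspace_scale)
    ultimately show ?case using \<nu> F by (intro exI[of _ "insert \<nu> F"] exI[of _ ?u]) simp
  qed
  then show ?thesis using that by blast
qed

text \<open>Otherwise placing \<open>- x\<close> at \<nu> next to the expansion of \<open>x\<close>
  gives a relation that violates independence.\<close>

lemma weight_vector_in_span:
  assumes "x \<in> V.span (\<Union>\<mu>\<in>X. weight_space \<mu>)" "x \<in> weight_space \<nu>" "x \<noteq> 0"
  shows "\<nu> \<in> X"
proof (rule ccontr)
  assume "\<nu> \<notin> X"
  obtain F u where F: "finite F" "F \<subseteq> X" "\<And>\<mu>. \<mu> \<in> F \<Longrightarrow> u \<mu> \<in> weight_space \<mu>" "x = (\<Sum>\<mu>\<in>F. u \<mu>)"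
    using span_weight_spacesE[OF assms(1)] by metis
  let ?u = "u(\<nu> := - x)"
  have "\<nu> \<notin> F" using F \<open>\<nu> \<notin> X\<close> by blast
  then have "(\<Sum>\<mu>\<in>F. ?u \<mu>) = (\<Sum>\<mu>\<in>F. u \<mu>)" by (intro sum.cong) auto
  then have "(\<Sum>\<mu>\<in>insert \<nu> F. ?u \<mu>) = 0" using F \<open>\<nu> \<notin> F\<close> by simp
  moreover have "?u \<mu> \<in> weight_space \<mu>" if "\<mu> \<in> insert \<nu> F" for \<mu>
    using that F(3) assms(2) V.subspace_neg[OF subspace_weight_space] by auto
  ultimately have "?u \<nu> = 0" using F(1) weight_spaces_independent[of "insert \<nu> F" ?u] by blast
  then show False using assms(3) by simp
qed

section \<open>Submodules generated by lowering operators\<close>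

text \<open>The elements of the algebra that map a subspace into itself form a Lie subalgebra, so
  stability may be tested on the generators.\<close>

lemma submoduleI:
  assumes "V.subspace W" "\<And>x w. w \<in> W \<Longrightarrow> act (cartan x) w \<in> W"
    and "\<And>i w. \<lbrakk>i \<le> n; w \<in> W\<rbrakk> \<Longrightarrow> act (e i) w \<in> W" "\<And>i w. \<lbrakk>i \<le> n; w \<in> W\<rbrakk> \<Longrightarrow> act (f i) w \<in> W"
  shows "submodule W"
proof -
  let ?S = "{x. \<forall>w\<in>W. act x w \<in> W}"
  have "lie_subalgebra ?S"
    using assms(1) unfolding lie_subalgebra_def G.subspace_def
    by (auto simp: act_add_left act_scale_left act_bracket V.subspace_0
        intro!: V.subspace_add V.subspace_scale V.subspace_diff)
  then have "?S = UNIV" using assms(2-4) by (intro generates) auto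
  then show ?thesis using assms(1) by (auto simp: submodule_def)
qed

lemma act_span_closed:
  assumes "\<And>u. u \<in> S \<Longrightarrow> act x u \<in> V.span S" "w \<in> V.span S"
  shows "act x w \<in> V.span S"
  using assms(2)
  by (induction rule: V.span_induct_alt)
    (simp_all add: act_add act_scale assms(1) V.span_zero V.span_add V.span_scale)

text \<open>The span of these words is U(n_-) w, obtained without constructing the enveloping
  algebra.\<close>

inductive_set f_words :: "'v \<Rightarrow> 'v set" for w where
  base: "w \<in> f_words w"
| step: "\<lbrakk>u \<in> f_words w; i \<le> n\<rbrakk> \<Longrightarrow> act (f i) u \<in> f_words w"

lemma f_words_weight:
  assumes "u \<in> f_words w" "w \<in> weight_space \<mu>"
  shows "\<exists>b. u \<in> weight_space (lower \<mu> b)"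
  using assms
proof (induction)
  case base
  then show ?case by (metis lower_zero)
next
  case (step u i)
  then obtain b where "u \<in> weight_space (lower \<mu> b)" by blast
  from act_f_weight_space_lower[OF this step.hyps(2)] show ?case by blast
qed

text \<open>Words are weight vectors, so the Cartan subalgebra only rescales them. By induction on
  the word, \<open>e i\<close> moves past each \<open>f j\<close> at the cost of a Cartan element
  until it reaches \<open>w\<close> and kills it.\<close>

lemma submodule_span_f_words:
  assumes w: "w \<in> weight_space \<mu>" "\<And>i. i \<le> n \<Longrightarrow> act (e i) w = 0"
  shows "submodule (V.span (f_words w))"
proof (rule submoduleI)
  have cart: "act (cartan x) u \<in> V.span (f_words w)" if u: "u \<in> f_words w" for x u
  proof -
    obtain b where "u \<in> weight_space (lower \<mu> b)" using f_words_weight[OF u w(1)] by blast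
    then show ?thesis using u by (simp add: weight_space_def V.span_base V.span_scale)
  qed
  then show "act (cartan x) u \<in> V.span (f_words w)" if "u \<in> V.span (f_words w)" for x u
    using that by (rule act_span_closed)
  have fcl: "act (f i) u \<in> V.span (f_words w)" if "i \<le> n" "u \<in> V.span (f_words w)" for i u
    using that by (auto intro: V.span_base f_words.step act_span_closed[of "f_words w"])
  then show "act (f i) u \<in> V.span (f_words w)" if "i \<le> n" "u \<in> V.span (f_words w)" for i u
    using that .
  have "act (e i) u \<in> V.span (f_words w)" if "u \<in> f_words w" "i \<le> n" for i u
    using that(1)
  proof (induction)
    case base
    show ?case using w(2)[OF that(2)] by (simp add: V.span_zero)
  next
    case (step u j)
    have "act (bracket (e i) (f j)) u \<in> V.span (f_words w)"
      using bracket_e_f[OF that(2) step.hyps(2)] cart[OF step.hyps(1)] by (simp add: V.span_zero)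
    then show ?case unfolding act_commute[of "e i"] using fcl step by (simp add: V.span_add)
  qed
  then show "act (e i) u \<in> V.span (f_words w)" if "i \<le> n" "u \<in> V.span (f_words w)" for i u
    using that by (auto intro: act_span_closed[of "f_words w"])
qed simp

lemma weights_below:
  assumes "V.span (f_words w) = UNIV" "w \<in> weight_space \<mu>" "x \<in> weight_space \<nu>" "x \<noteq> 0"
  shows "\<exists>b. \<nu> = lower \<mu> b"
proof -
  have "f_words w \<subseteq> (\<Union>\<mu>'\<in>range (lower \<mu>). weight_space \<mu>')"
    using f_words_weight[OF _ assms(2)] by blast
  then have "x \<in> V.span (\<Union>\<mu>'\<in>range (lower \<mu>). weight_space \<mu>')"
    using V.span_mono assms(1) by blast
  then show ?thesis using weight_vector_in_span assms(3,4) by blast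
qed

lemma highest_weight_vectorE:
  assumes "highest_weight_module \<Lambda>"
  obtains v where "v \<noteq> 0" "v \<in> weight_space \<Lambda>" "\<And>i. i \<le> n \<Longrightarrow> act (e i) v = 0"
    "V.span (f_words v) = UNIV"
proof -
  obtain v where v: "v \<noteq> 0" "v \<in> weight_space \<Lambda>" "\<forall>i\<le>n. act (e i) v = 0"
    "\<forall>W. submodule W \<and> v \<in> W \<longrightarrow> W = UNIV"
    using assms unfolding highest_weight_module_def by blast
  have "submodule (V.span (f_words v))" using v by (intro submodule_span_f_words) auto
  then have "V.span (f_words v) = UNIV" using v(4) by (simp add: V.span_base f_words.base)
  then show ?thesis using that v by blast
qed

lemma weightsE:
  assumes "\<mu> \<in> weights"
  obtains u where "u \<noteq> 0" "u \<in> weight_space \<mu>"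
proof -
  have "0 \<in> weight_space \<mu>" using subspace_weight_space V.subspace_0 by blast
  then show ?thesis using assms that unfolding weights_def by blast
qed

lemma weightsI:
  "\<lbrakk>Vector_Spaces.linear scaleH (*) \<mu>; u \<in> weight_space \<mu>; u \<noteq> 0\<rbrakk> \<Longrightarrow> \<mu> \<in> weights"
  by (auto simp: weights_def)

lemma weight_below_highest_weight:
  assumes "highest_weight_module \<Lambda>" "\<nu> \<in> weights"
  shows "\<exists>b. \<nu> = lower \<Lambda> b"
  using assms by (elim highest_weight_vectorE weightsE) (rule weights_below)

lemma highest_weight_in_weights:
  assumes "highest_weight_module \<Lambda>" "Vector_Spaces.linear scaleH (*) \<Lambda>"
  shows "\<Lambda> \<in> weights"
  using assms by (elim highest_weight_vectorE) (rule weightsI)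

section \<open>Strings of simple roots and dominant weights\<close>

text \<open>With m the value of \<mu> on h_i, each passage of f_i across an e_i contributes -(m +
  2j), for j = 0, ..., k. The total is -(k + 1)(m + k), which never vanishes when m is
  positive.\<close>

lemma act_f_act_e_power:
  assumes u: "u \<in> weight_space \<mu>" "act (f i) u = 0" and i: "i \<le> n"
  shows "(act (e i) ^^ k) u \<in> weight_space (\<lambda>x. \<mu> x + of_nat k * alpha i x)"
    and "act (f i) ((act (e i) ^^ Suc k) u) =
      scaleV (- (of_nat (Suc k) * (\<mu> (coroot i) + of_nat k))) ((act (e i) ^^ k) u)"
proof -
  show wt: "(act (e i) ^^ k) u \<in> weight_space (\<lambda>x. \<mu> x + of_nat k * alpha i x)" for k
  proof (induction k)
    case (Suc k)
    show ?case using act_e_weight_space[OF Suc i] by (simp add: algebra_simps)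
  qed (use u in simp)
  have fe: "act (f i) (act (e i) w) = act (e i) (act (f i) w) - act (cartan (coroot i)) w" for w
    using act_bracket[of "e i" "f i" w] bracket_e_f[OF i i] by simp
  have h: "act (cartan (coroot i)) ((act (e i) ^^ k) u)
      = scaleV (\<mu> (coroot i) + 2 * of_nat k) ((act (e i) ^^ k) u)" for k
    using wt[of k] i diag[OF i] by (simp add: weight_space_def alpha_coroot mult.commute)
  show "act (f i) ((act (e i) ^^ Suc k) u) =
      scaleV (- (of_nat (Suc k) * (\<mu> (coroot i) + of_nat k))) ((act (e i) ^^ k) u)"
  proof (induction k)
    case 0
    show ?case using fe[of u] h[of 0] u(2) by simp
  next
    case (Suc k)
    have "act (f i) ((act (e i) ^^ Suc (Suc k)) u) =
        act (e i) (act (f i) ((act (e i) ^^ Suc k) u)) -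
        scaleV (\<mu> (coroot i) + 2 * of_nat (Suc k)) ((act (e i) ^^ Suc k) u)"
      using fe[of "(act (e i) ^^ Suc k) u"] h[of "Suc k"] by simp
    also have "act (e i) (act (f i) ((act (e i) ^^ Suc k) u)) =
        scaleV (- (of_nat (Suc k) * (\<mu> (coroot i) + of_nat k))) ((act (e i) ^^ Suc k) u)"
      unfolding Suc by (simp add: act_scale)
    finally show ?case
      by (simp only: V.scale_left_diff_distrib[symmetric]) (simp add: algebra_simps)
  qed
qed

text \<open>A weight vector killed by \<open>f\<^sub>i\<close> whose weight is positive on \<open>h\<^sub>i\<close> would be a lowest weight
  vector of an infinite \<open>e\<^sub>i\<close>-string, which the highest weight forbids.\<close>

lemma weight_minus_simple_root:
  assumes hw: "highest_weight_module \<Lambda>" and \<mu>: "\<mu> \<in> weights" and i: "i \<le> n"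
    and pos: "\<mu> (coroot i) = of_nat m" "m > 0"
  shows "(\<lambda>x. \<mu> x - alpha i x) \<in> weights"
proof -
  obtain u where u: "u \<noteq> 0" "u \<in> weight_space \<mu>" using weightsE[OF \<mu>] .
  have lin: "Vector_Spaces.linear scaleH (*) \<mu>" using \<mu> by (simp add: weights_def)
  have "act (f i) u \<noteq> 0"
  proof
    assume fu: "act (f i) u = 0"
    have ne: "(act (e i) ^^ k) u \<noteq> 0" for k
    proof (induction k)
      case (Suc k)
      have "\<mu> (coroot i) + of_nat k \<noteq> 0" using pos by (simp flip: of_nat_add)
      then have "act (f i) ((act (e i) ^^ Suc k) u) \<noteq> 0"
        unfolding act_f_act_e_power(2)[OF u(2) fu i] using Suc
        by (simp only: V.scale_eq_0_iff neg_equal_0_iff_equal mult_eq_0_iff of_nat_eq_0_iff) simp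
      then show ?case by fastforce
    qed (use u in simp)
    obtain b where b: "\<mu> = lower \<Lambda> b" using weight_below_highest_weight[OF hw \<mu>] by blast
    obtain v where v: "v \<in> weight_space \<Lambda>" "V.span (f_words v) = UNIV"
      using highest_weight_vectorE[OF hw] by metis
    \<comment> \<open>Adding alpha_i one time more than it was subtracted from \<Lambda> leaves the
      cone below \<Lambda>.\<close>
    obtain b' where "(\<lambda>x. \<mu> x + of_nat (Suc (b i)) * alpha i x) = lower \<Lambda> b'"
      using weights_below[OF v(2,1) act_f_act_e_power(1)[OF u(2) fu i] ne] by blast
    then have "lower \<Lambda> b = lower \<Lambda> (b'(i := b' i + Suc (b i)))"
      unfolding lower_add[OF i] b by (auto simp: fun_eq_iff algebra_simps)
    from lower_eqD[OF this i] show False by simp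
  qed
  moreover have "Vector_Spaces.linear scaleH (*) (\<lambda>x. \<mu> x - alpha i x)"
    using lin alpha_linear[OF i] by (simp add: linear_functional_iff algebra_simps)
  ultimately show ?thesis using weightsI act_f_weight_space[OF u(2) i] by blast
qed

text \<open>Among the weights between \<open>lower \<Lambda> c\<close> and \<open>\<Lambda>\<close> take \<open>lower \<Lambda> b\<close> with \<open>b\<close> as large as
  possible. If \<open>z = c - b\<close> were nonzero, then \<open>A z \<le> 0\<close>, so \<open>z\<close> would be proportional to the
  marks, and \<open>lower \<Lambda> c\<close> would vanish on all simple coroots.\<close>

lemma dominant_in_weights:
  assumes hw: "highest_weight_module \<Lambda>" and lin: "Vector_Spaces.linear scaleH (*) \<Lambda>"
    and L: "\<And>i. i \<le> n \<Longrightarrow> \<Lambda> (coroot i) = of_nat (L i)"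
    and dom: "dominant_integral (lower \<Lambda> c)" and k: "k \<le> n" "lower \<Lambda> c (coroot k) \<noteq> 0"
  shows "lower \<Lambda> c \<in> weights"
proof -
  define q where "q b i = int (L i) - (\<Sum>j\<le>n. A i j * int (b j))" for b i
  have qc: "q c i \<ge> 0" if "i \<le> n" for i
    using dom that dominant_integral_lower_iff[of \<Lambda> L c, OF lin L] by (simp add: q_def)
  let ?P = "\<lambda>b. (\<forall>i. b i \<le> c i) \<and> lower \<Lambda> b \<in> weights"
  have "?P (\<lambda>_. 0)" using highest_weight_in_weights[OF hw lin] by simp
  moreover have "\<forall>b. ?P b \<longrightarrow> (\<Sum>i\<le>n. b i) < Suc (\<Sum>i\<le>n. c i)"
    by (auto simp: less_Suc_eq_le intro: sum_mono)
  ultimately have "\<exists>b. ?P b \<and> (\<forall>b'. ?P b' \<longrightarrow> (\<Sum>i\<le>n. b' i) \<le> (\<Sum>i\<le>n. b i))"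
    by (rule ex_has_greatest_nat)
  then obtain b where b: "?P b" and max: "\<And>b'. ?P b' \<Longrightarrow> (\<Sum>i\<le>n. b' i) \<le> (\<Sum>i\<le>n. b i)"
    by blast
  define z where "z j = int (c j) - int (b j)" for j
  have z: "z j \<ge> 0" for j using b by (simp add: z_def)
  have Az: "(\<Sum>j\<le>n. A i j * z j) = q b i - q c i" for i
    by (simp add: z_def q_def right_diff_distrib sum_subtractf)
  have qb: "q b i \<le> 0" if "i \<le> n" "z i > 0" for i
  proof (rule ccontr)
    assume "\<not> q b i \<le> 0"
    then have "lower \<Lambda> b (coroot i) = of_nat (nat (q b i))" "nat (q b i) > 0"
      using lower_coroot[of i \<Lambda> L b, OF that(1) L[OF that(1)]] by (simp_all add: q_def)
    then have "(\<lambda>x. lower \<Lambda> b x - alpha i x) \<in> weights"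
      using weight_minus_simple_root[OF hw _ that(1)] b by blast
    then have "?P (b(i := b i + 1))"
      using lower_add[OF that(1), of \<Lambda> b 1] b that by (auto simp: z_def)
    then have "(\<Sum>j\<le>n. (b(i := b i + 1)) j) \<le> (\<Sum>j\<le>n. b j)" using max by blast
    moreover have "(\<Sum>j\<le>n. (b(i := b i + 1)) j) > (\<Sum>j\<le>n. b j)"
      using that by (intro sum_strict_mono_ex1) auto
    ultimately show False by simp
  qed
  \<comment> \<open>Where \<open>z\<close> vanishes, only off-diagonal entries meet the nonnegative
    \<open>z\<close>; where it is positive, \<open>qb\<close> and dominance give
    \<open>q b i \<le> 0 \<le> q c i\<close>.\<close>
  have nonpos: "(\<Sum>j\<le>n. A i j * z j) \<le> 0" if "i \<le> n" for i
  proof (cases "z i = 0")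
    case True
    then show ?thesis using z off_diag that
      by (intro sum_nonpos) (metis atMost_iff mult_nonpos_nonneg mult_zero_right order_refl)
  next
    case False
    then show ?thesis unfolding Az using qb[OF that] qc[OF that] z[of i] by simp
  qed
  have "z i = 0" if i: "i \<le> n" for i
  proof (rule ccontr)
    assume "z i \<noteq> 0"
    then have zi: "z i > 0" using z[of i] by simp
    have proportional: "z i * int (a j) = z j * int (a i)" if "j \<le> n" for j
      using nonpos_image_proportional[OF nonpos i that] by simp
    \<comment> \<open>Positive marks make \<open>z\<close> positive at \<open>k\<close> too, so
      \<open>q b k \<le> 0\<close>; as \<open>A z\<close> vanishes there,
      \<open>q c k = q b k\<close> is squeezed to zero, against the hypothesis on
      \<open>k\<close>.\<close>
    have "z k > 0" using proportional[OF k(1)] zi marks_pos[OF i] marks_pos[OF k(1)]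
      by (metis mult_pos_pos of_nat_0_less_iff zero_less_mult_pos2)
    then have "q b k \<le> 0" using qb k by blast
    have "(\<Sum>j\<le>n. A k j * z j) * int (a i) = (\<Sum>j\<le>n. A k j * int (a j)) * z i"
      unfolding sum_distrib_right using proportional by (intro sum.cong) (auto simp: algebra_simps)
    then have "q b k = q c k" using marks_kernel[OF k(1)] marks_pos[OF i] Az[of k] by simp
    then have "q c k = 0" using qc[OF k(1)] \<open>q b k \<le> 0\<close> by simp
    then show False using k lower_coroot[of k \<Lambda> L c, OF k(1) L[OF k(1)]] by (simp add: q_def)
  qed
  then have "lower \<Lambda> b = lower \<Lambda> c" by (intro lower_cong) (simp add: z_def)
  then show ?thesis using b by simp
qed

section \<open>Level 0\<close>

text \<open>Each f_i v is killed by every e_j, because [e_i, f_i] = h_i acts on v by zero. If f_i v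
  were nonzero, irreducibility would make it generate the module, and the weight of v would lie
  strictly below itself. So only v remains.\<close>

lemma weights_trivial:
  assumes V: "is_V \<Lambda>" and lin: "Vector_Spaces.linear scaleH (*) \<Lambda>"
    and zero: "\<And>i. i \<le> n \<Longrightarrow> \<Lambda> (coroot i) = 0"
  shows "weights = {\<Lambda>}"
proof -
  have hw: "highest_weight_module \<Lambda>" and irr: "irreducible_module" using V by (auto simp: is_V_def)
  obtain v where v: "v \<noteq> 0" "v \<in> weight_space \<Lambda>" "\<And>i. i \<le> n \<Longrightarrow> act (e i) v = 0"
    "V.span (f_words v) = UNIV"
    using highest_weight_vectorE[OF hw] by metis
  have fv: "act (f i) v = 0" if i: "i \<le> n" for i
  proof (rule ccontr)
    let ?w = "act (f i) v"
    assume ne: "?w \<noteq> 0"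
    have wt: "?w \<in> weight_space (lower \<Lambda> ((\<lambda>_. 0)(i := 0 + 1)))"
      using act_f_weight_space[OF v(2) i] lower_add[OF i, of \<Lambda> "\<lambda>_. 0" 1] by simp
    have "act (e j) ?w = 0" if "j \<le> n" for j
      using v zero[OF i] that i by (simp add: act_commute[of "e j"] bracket_e_f weight_space_def)
    then have "submodule (V.span (f_words ?w))" by (rule submodule_span_f_words[OF wt])
    moreover have "?w \<in> V.span (f_words ?w)" by (simp add: V.span_base f_words.base)
    ultimately have "V.span (f_words ?w) = UNIV"
      using irr ne unfolding irreducible_module_def by blast
    then obtain b where "\<Lambda> = lower (lower \<Lambda> ((\<lambda>_. 0)(i := 0 + 1))) b"
      using weights_below[OF _ wt v(2,1)] by blast
    then have "lower \<Lambda> (\<lambda>_. 0) = lower \<Lambda> (\<lambda>j. ((\<lambda>_. 0)(i := 0 + 1)) j + b j)"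
      by (simp only: lower_lower lower_zero)
    from lower_eqD[OF this i] show False by simp
  qed
  have "u = v \<or> u = 0" if "u \<in> f_words v" for u
    using that by induction (auto simp: fv)
  then have "f_words v \<subseteq> (\<Union>\<mu>\<in>{\<Lambda>}. weight_space \<mu>)"
    using v(2) V.subspace_0[OF subspace_weight_space] by force
  then have all: "x \<in> V.span (\<Union>\<mu>\<in>{\<Lambda>}. weight_space \<mu>)" for x using V.span_mono v(4) by blast
  have "\<nu> \<in> {\<Lambda>}" if \<nu>: "\<nu> \<in> weights" for \<nu>
  proof -
    obtain x where "x \<noteq> 0" "x \<in> weight_space \<nu>" using weightsE[OF \<nu>] .
    then show ?thesis using weight_vector_in_span[OF all] by blast
  qed
  then show ?thesis using highest_weight_in_weights[OF hw lin] by blast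
qed

lemma max_dominant_weights_trivial:
  assumes "is_V (\<lambda>_. 0)"
  shows "max_dominant_weights = {\<lambda>_. 0}"
proof -
  have lin: "Vector_Spaces.linear scaleH (*) (\<lambda>_. 0)" by (simp add: linear_functional_iff)
  then have w: "weights = {\<lambda>_. 0}" using assms by (intro weights_trivial) auto
  \<comment> \<open>A nonzero null root is what makes the only weight maximal; the scaling element
    detects it through the mark \<open>a 0\<close>.\<close>
  have "null_root d \<noteq> 0"
    using root_combination_d[of "\<lambda>j. int (a j)"] marks_pos[of 0] by (simp add: null_root_def)
  then have "null_root \<noteq> (\<lambda>_. 0)" by auto
  then have "(\<lambda>_. 0) \<in> maximal_weights" unfolding maximal_weights_def w by simp
  moreover have "dominant_integral (\<lambda>_. 0)" using lin by (simp add: dominant_integral_def)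
  moreover have "max_dominant_weights \<subseteq> {\<lambda>_. 0}"
    unfolding max_dominant_weights_def maximal_weights_def w by blast
  ultimately show ?thesis unfolding max_dominant_weights_def by blast
qed

end

section \<open>The type $C_n^{(1)}$\<close>

lemma even_int_diff_iff: "even (int x - int y) \<longleftrightarrow> x mod 2 = y mod 2"
  by (simp add: mod2_eq_if)

text \<open>Second differences kill the linear function i in the interior columns; columns 0 and n
  give -2 and 2.\<close>

lemma cartan_C_weighted_column_sum_even:
  assumes "2 \<le> n" "j \<le> n"
  shows "even (\<Sum>i\<le>n. int i * cartan_C n i j)"
proof -
  consider "j = 0" | "j = n" | "0 < j" "j < n" using assms by linarith
  then show ?thesis
  proof cases
    case 1
    have "(\<Sum>i\<le>n. int i * cartan_C n i j) = (\<Sum>i\<in>{0,1}. int i * cartan_C n i j)"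
      by (rule sum_restrict_support) (use assms 1 in \<open>auto simp: cartan_C_def\<close>)
    then show ?thesis using assms 1 by (simp add: cartan_C_def)
  next
    case 2
    have "(\<Sum>i\<le>n. int i * cartan_C n i j) = (\<Sum>i\<in>{n-1,n}. int i * cartan_C n i j)"
      by (rule sum_restrict_support) (use assms 2 in \<open>auto simp: cartan_C_def\<close>)
    then show ?thesis using assms 2 by (simp add: cartan_C_def)
  next
    case 3
    have "(\<Sum>i\<le>n. int i * cartan_C n i j) = (\<Sum>i\<in>{j-1,j,j+1}. int i * cartan_C n i j)"
      by (rule sum_restrict_support) (use assms 3 in \<open>auto simp: cartan_C_def\<close>)
    moreover obtain k where "j = Suc k" using 3 by (cases j) auto
    ultimately show ?thesis using assms 3 by (auto simp: cartan_C_def)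
  qed
qed

lemma cartan_C_image:
  assumes "2 \<le> n"
  shows "(\<Sum>i\<le>n. \<Sum>j\<le>n. cartan_C n i j * z j) = 0"
    and "even (\<Sum>i\<le>n. int i * (\<Sum>j\<le>n. cartan_C n i j * z j))"
proof -
  have "(\<Sum>i\<le>n. \<Sum>j\<le>n. cartan_C n i j * z j) = (\<Sum>j\<le>n. (\<Sum>i\<le>n. cartan_C n i j) * z j)"
    unfolding sum_distrib_right by (rule sum.swap)
  then show "(\<Sum>i\<le>n. \<Sum>j\<le>n. cartan_C n i j * z j) = 0"
    using cartan_C_column_sum[OF assms] by simp
  have "(\<Sum>i\<le>n. int i * (\<Sum>j\<le>n. cartan_C n i j * z j)) =
      (\<Sum>j\<le>n. (\<Sum>i\<le>n. int i * cartan_C n i j) * z j)"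
    unfolding sum_distrib_right sum_distrib_left mult.assoc by (rule sum.swap)
  also have "even \<dots>"
    using cartan_C_weighted_column_sum_even[OF assms] by (intro dvd_sum) (auto intro: dvd_mult2)
  finally show "even (\<Sum>i\<le>n. int i * (\<Sum>j\<le>n. cartan_C n i j * z j))" .
qed

text \<open>Halving the two end coordinates of a vector \<open>g\<close> turns \<open>cartan_C n\<close> into the discrete
  Laplacian of the path \<open>0, \<dots>, n\<close>.\<close>

lemma cartan_C_row:
  fixes g z :: "nat \<Rightarrow> int"
  assumes "2 \<le> n" "i \<le> n" "g 0 = 2 * z 0" "g n = 2 * z n" "\<And>j. \<lbrakk>0 < j; j < n\<rbrakk> \<Longrightarrow> g j = z j"
  shows "(\<Sum>j\<le>n. cartan_C n i j * z j) =
    (if i = 0 then g 0 - g 1 else if i = n then g n - g (n - 1)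
     else 2 * g i - g (i - 1) - g (i + 1))" (is "sum ?g _ = _")
proof -
  consider "i = 0" | "i = n" | "0 < i" "i < n" using assms by linarith
  then show ?thesis
  proof cases
    case 1
    have "sum ?g {..n} = sum ?g {0,1}"
      by (rule sum_restrict_support) (use assms 1 in \<open>auto simp: cartan_C_def\<close>)
    then show ?thesis using assms(1,3) assms(5)[of 1] 1 by (simp add: cartan_C_def)
  next
    case 2
    have "sum ?g {..n} = sum ?g {n-1,n}"
      by (rule sum_restrict_support) (use assms 2 in \<open>auto simp: cartan_C_def\<close>)
    moreover have "n - 1 \<noteq> n" "cartan_C n n (n - 1) = -1" "cartan_C n n n = 2" "g (n - 1) = z (n - 1)"
      using assms(1) assms(5)[of "n - 1"] by (auto simp: cartan_C_def)
    ultimately show ?thesis using assms(1,4) 2 by simp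
  next
    case 3
    have "sum ?g {..n} = sum ?g {i-1,i,i+1}"
      by (rule sum_restrict_support) (use assms 3 in \<open>auto simp: cartan_C_def\<close>)
    moreover obtain k where k: "i = Suc k" using 3 by (cases i) auto
    moreover have "cartan_C n i (i-1) * z (i-1) = - g (i-1)"
      using assms(3) assms(5)[of k] 3 k by (cases "k = 0") (auto simp: cartan_C_def)
    moreover have "cartan_C n i (i+1) * z (i+1) = - g (i+1)"
      using assms(4) assms(5)[of "i+1"] 3 by (cases "i + 1 = n") (auto simp: cartan_C_def)
    moreover have "cartan_C n i i * z i = 2 * g i"
      using assms(5)[of i] 3 by (simp add: cartan_C_def)
    ultimately show ?thesis using 3 by simp
  qed
qed

text \<open>The negated double partial sums \<open>- D\<close> have second differences
  \<open>c\<close>, and vanishing total gives the equation at \<open>n\<close>. Halving at 0 is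
  harmless as \<open>D 0 = 0\<close>; at \<open>n\<close> it is exact because \<open>D n\<close> is
  minus the weighted sum.\<close>

lemma cartan_C_solvable:
  fixes c :: "nat \<Rightarrow> int"
  assumes n: "2 \<le> n" and sum0: "(\<Sum>i\<le>n. c i) = 0" and even: "even (\<Sum>i\<le>n. int i * c i)"
  shows "\<exists>z. \<forall>i\<le>n. (\<Sum>j\<le>n. cartan_C n i j * z j) = c i"
proof -
  define D where "D k = (\<Sum>j<k. \<Sum>i\<le>j. c i)" for k
  have D_Suc: "D (Suc k) = D k + (\<Sum>i\<le>k. c i)" for k by (simp add: D_def)
  have "D k = int k * (\<Sum>i\<le>k. c i) - (\<Sum>i\<le>k. int i * c i)" for k
    by (induction k) (simp_all add: D_Suc algebra_simps, simp add: D_def)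
  then have "even (D n)" using sum0 even by simp
  define z where "z j = (if j = n then - D n div 2 else - D j)" for j
  have "(\<Sum>j\<le>n. cartan_C n i j * z j) = c i" if i: "i \<le> n" for i
  proof -
    have "(\<Sum>j\<le>n. cartan_C n i j * z j) =
      (if i = 0 then - D 0 - - D 1 else if i = n then - D n - - D (n - 1)
       else 2 * - D i - - D (i - 1) - - D (i + 1))"
      by (rule cartan_C_row) (use n i \<open>even (D n)\<close> in \<open>auto simp: z_def D_def\<close>)
    also have "\<dots> = c i"
    proof (cases i)
      case 0
      then show ?thesis by (simp add: D_def)
    next
      case (Suc k)
      then have "D i = D k + (\<Sum>j\<le>k. c j)" "D (Suc i) = D i + (\<Sum>j\<le>i. c j)"
        "(\<Sum>j\<le>i. c j) = (\<Sum>j\<le>k. c j) + c i"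
        by (simp_all add: D_Suc)
      then show ?thesis using Suc sum0 by auto
    qed
    finally show ?thesis .
  qed
  then show ?thesis by blast
qed

context affine_kac_moody_module
begin

section \<open>Maximal dominant weights as compositions\<close>

text \<open>Because \<open>a 0 = 1\<close>, two vectors \<open>b\<close> with equal coroot values
  \<open>q b\<close> differ by an integer multiple of the marks. Each class is thus ordered by
  \<open>b 0\<close>, and its maximal weight is the one with the least \<open>b 0\<close>.\<close>

lemma ex_bij_betw_max_dominant_weights:
  assumes n: "2 \<le> n" and C: "A = cartan_C n" "a = marks_C n"
    and hw: "highest_weight_module \<Lambda>" and lin: "Vector_Spaces.linear scaleH (*) \<Lambda>"
    and L: "\<And>i. i \<le> n \<Longrightarrow> \<Lambda> (coroot i) = of_nat (L i)"
    and level: "(\<Sum>i\<le>n. L i) = l" "l > 0"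
  shows "\<exists>g. bij_betw g max_dominant_weights (parity_compositions n l (\<Sum>i\<le>n. i * L i))"
proof -
  let ?P = "parity_compositions n l (\<Sum>i\<le>n. i * L i)"
  define q where "q b i = int (L i) - (\<Sum>j\<le>n. A i j * int (b j))" for b i
  have coroot: "lower \<Lambda> b (coroot i) = of_int (q b i)" if "i \<le> n" for b i
    unfolding q_def by (rule lower_coroot[of i \<Lambda> L b, OF that L[OF that]])
  have dom: "dominant_integral (lower \<Lambda> b) \<longleftrightarrow> (\<forall>i\<le>n. q b i \<ge> 0)" for b
    using dominant_integral_lower_iff[of \<Lambda> L b, OF lin L] by (simp add: q_def)
  have q_sum: "(\<Sum>i\<le>n. q b i) = int l" for b
    using cartan_C_image(1)[OF n, of "\<lambda>j. int (b j)"] level(1)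
    by (simp add: q_def C sum_subtractf flip: of_nat_sum)
  have in_weights: "lower \<Lambda> b \<in> weights" if "\<forall>i\<le>n. q b i \<ge> 0" for b
  proof -
    \<comment> \<open>The coroot values add up to the level, so positive level prevents them from
      all vanishing.\<close>
    have "\<exists>k\<le>n. q b k \<noteq> 0"
    proof (rule ccontr)
      assume "\<not> ?thesis"
      then have "(\<Sum>i\<le>n. q b i) = 0" by simp
      then show False using q_sum[of b] level(2) by simp
    qed
    then obtain k where "k \<le> n" "q b k \<noteq> 0" by blast
    then show ?thesis
      using dominant_in_weights[of \<Lambda> L b k, OF hw lin L] that coroot[of k b] dom[of b] by simp
  qed
  have a0: "a 0 = 1" by (simp add: C marks_C_def)
  have proportional: "int (b i) = int (b' i) + (int (b 0) - int (b' 0)) * int (a i)"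
    if "\<And>i. i \<le> n \<Longrightarrow> q b i = q b' i" "i \<le> n" for b b' i
  proof -
    have "(\<Sum>j\<le>n. A k j * (int (b j) - int (b' j))) = 0" if "k \<le> n" for k
      using \<open>\<And>i. i \<le> n \<Longrightarrow> q b i = q b' i\<close>[OF that]
      by (simp add: q_def right_diff_distrib sum_subtractf)
    then have "(int (b i) - int (b' i)) * int (a 0) = (int (b 0) - int (b' 0)) * int (a i)"
      using that(2) by (intro nonpos_image_proportional) auto
    then show ?thesis using a0 by simp
  qed
  \<comment> \<open>If \<open>b 0\<close> exceeded \<open>b' 0\<close>, then \<open>b\<close> would
    dominate the marks, and subtracting them would give a dominant weight one null root
    higher.\<close>
  have minimal: "b 0 \<le> b' 0"
    if "lower \<Lambda> b \<in> maximal_weights" and same: "\<And>i. i \<le> n \<Longrightarrow> q b i = q b' i"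
      and q: "\<forall>i\<le>n. q b i \<ge> 0" for b b'
  proof (rule ccontr)
    assume "\<not> b 0 \<le> b' 0"
    then have pos: "int (b 0) - int (b' 0) \<ge> 1" by simp
    have ge: "a i \<le> b i" if "i \<le> n" for i
    proof -
      have "1 * int (a i) \<le> (int (b 0) - int (b' 0)) * int (a i)"
        using pos by (intro mult_right_mono) auto
      then show ?thesis using proportional[OF same that] by simp
    qed
    let ?b = "\<lambda>i. b i - a i"
    have "q ?b i = q b i" if "i \<le> n" for i
    proof -
      have "(\<Sum>j\<le>n. A i j * int (b j - a j)) = (\<Sum>j\<le>n. A i j * int (b j) - A i j * int (a j))"
        using ge by (intro sum.cong) (auto simp: of_nat_diff right_diff_distrib)
      then show ?thesis using marks_kernel[OF that] by (simp add: q_def sum_subtractf)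
    qed
    then have "lower \<Lambda> ?b \<in> weights" using q by (intro in_weights) auto
    moreover have "lower \<Lambda> b = lower \<Lambda> (\<lambda>i. ?b i + a i)" using ge by (intro lower_cong) auto
    then have "(\<lambda>x. lower \<Lambda> b x + null_root x) = lower \<Lambda> ?b" by (simp add: lower_plus_null_root)
    ultimately show False using that(1) by (simp add: maximal_weights_def)
  qed
  have maxE: "\<exists>b. \<mu> = lower \<Lambda> b \<and> (\<forall>i\<le>n. q b i \<ge> 0) \<and> lower \<Lambda> b \<in> maximal_weights"
    if \<mu>: "\<mu> \<in> max_dominant_weights" for \<mu>
  proof -
    obtain b where "\<mu> = lower \<Lambda> b"
      using \<mu> weight_below_highest_weight[OF hw]
      by (auto simp: max_dominant_weights_def maximal_weights_def)
    then show ?thesis using \<mu> dom by (auto simp: max_dominant_weights_def)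
  qed
  define g where "g \<mu> = (\<lambda>i. if i \<le> n then nat \<lfloor>Re (\<mu> (coroot i))\<rfloor> else 0)" for \<mu>
  have g: "int (g (lower \<Lambda> b) i) = q b i" if "\<forall>i\<le>n. q b i \<ge> 0" "i \<le> n" for b i
    using that coroot by (simp add: g_def)
  have "inj_on g max_dominant_weights"
  proof (rule inj_onI)
    fix \<mu> \<mu>' assume "\<mu> \<in> max_dominant_weights" "\<mu>' \<in> max_dominant_weights" and eq: "g \<mu> = g \<mu>'"
    then obtain b b' where b: "\<mu> = lower \<Lambda> b" "\<forall>i\<le>n. q b i \<ge> 0" "lower \<Lambda> b \<in> maximal_weights"
      and b': "\<mu>' = lower \<Lambda> b'" "\<forall>i\<le>n. q b' i \<ge> 0" "lower \<Lambda> b' \<in> maximal_weights"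
      using maxE by meson
    have same: "q b i = q b' i" if "i \<le> n" for i
      using g[OF b(2) that] g[OF b'(2) that] eq b(1) b'(1) by simp
    have "b 0 \<le> b' 0" "b' 0 \<le> b 0"
      using minimal[OF b(3) same b(2)] minimal[OF b'(3) same[symmetric] b'(2)] by simp_all
    then have "b i = b' i" if "i \<le> n" for i using proportional[OF same that] by simp
    then show "\<mu> = \<mu>'" unfolding b b' by (rule lower_cong)
  qed
  moreover have "g ` max_dominant_weights \<subseteq> ?P"
  proof
    fix m assume "m \<in> g ` max_dominant_weights"
    then obtain b where m: "m = g (lower \<Lambda> b)" and b: "\<forall>i\<le>n. q b i \<ge> 0" using maxE by blast
    have m_q: "int (m i) = q b i" if "i \<le> n" for i using g[OF b that] m by simp
    have "int (\<Sum>i\<le>n. m i) = (\<Sum>i\<le>n. q b i)" unfolding of_nat_sum using m_q by (intro sum.cong) auto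
    then have "(\<Sum>i\<le>n. m i) = l" unfolding q_sum by (simp only: of_nat_eq_iff)
    moreover have "int (\<Sum>i\<le>n. i * m i) = (\<Sum>i\<le>n. int i * q b i)"
      unfolding of_nat_sum of_nat_mult using m_q by (intro sum.cong) auto
    then have "int (\<Sum>i\<le>n. i * m i) = int (\<Sum>i\<le>n. i * L i) -
        (\<Sum>i\<le>n. int i * (\<Sum>j\<le>n. cartan_C n i j * int (b j)))"
      unfolding q_def C right_diff_distrib sum_subtractf of_nat_sum of_nat_mult .
    then have "even (int (\<Sum>i\<le>n. i * L i) - int (\<Sum>i\<le>n. i * m i))"
      using cartan_C_image(2)[OF n, of "\<lambda>j. int (b j)"] by (simp only: diff_diff_eq2 add_diff_cancel_left')
    then have "(\<Sum>i\<le>n. i * m i) mod 2 = (\<Sum>i\<le>n. i * L i) mod 2"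
      unfolding even_int_diff_iff by (rule sym)
    moreover have "\<forall>i>n. m i = 0" using m by (simp add: g_def)
    ultimately show "m \<in> ?P" unfolding parity_compositions_def by blast
  qed
  moreover have "?P \<subseteq> g ` max_dominant_weights"
  proof
    fix m assume m: "m \<in> ?P"
    define c where "c i = int (L i) - int (m i)" for i
    have "(\<Sum>i\<le>n. m i) = l" using m by (simp only: parity_compositions_def mem_Collect_eq)
    then have "(\<Sum>i\<le>n. c i) = 0" using level(1) by (simp add: c_def sum_subtractf flip: of_nat_sum)
    moreover have "(\<Sum>i\<le>n. int i * c i) = int (\<Sum>i\<le>n. i * L i) - int (\<Sum>i\<le>n. i * m i)"
      unfolding c_def right_diff_distrib sum_subtractf of_nat_sum of_nat_mult ..
    then have "even (\<Sum>i\<le>n. int i * c i)"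
      using m by (simp only: even_int_diff_iff parity_compositions_def mem_Collect_eq)
    ultimately obtain z where z: "\<And>i. i \<le> n \<Longrightarrow> (\<Sum>j\<le>n. A i j * z j) = c i"
      using cartan_C_solvable[OF n] unfolding C by blast
    let ?Q = "\<lambda>b. \<forall>i\<le>n. q b i = int (m i)"
    \<comment> \<open>The integer solution \<open>z\<close> may be negative. Adding \<open>k\<close>
      times the marks leaves \<open>A z\<close> unchanged, and marks of at least 1 make this
      \<open>k\<close> large enough.\<close>
    define k where "k = (\<Sum>j\<le>n. \<bar>z j\<bar>)"
    have "?Q (\<lambda>j. nat (z j + k * int (a j)))"
    proof (intro allI impI)
      fix i assume i: "i \<le> n"
      have "z j + k * int (a j) \<ge> 0" if "j \<le> n" for j
      proof -
        have "\<bar>z j\<bar> \<le> k" unfolding k_def using that by (intro member_le_sum) auto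
        moreover have "k * 1 \<le> k * int (a j)"
          using marks_pos[OF that] calculation by (intro mult_left_mono) auto
        ultimately show ?thesis by linarith
      qed
      then have "(\<Sum>j\<le>n. A i j * int (nat (z j + k * int (a j)))) =
          (\<Sum>j\<le>n. A i j * z j + k * (A i j * int (a j)))"
        by (intro sum.cong) (auto simp: algebra_simps)
      also have "\<dots> = c i"
        using z[OF i] marks_kernel[OF i] by (simp add: sum.distrib flip: sum_distrib_left)
      finally show "q (\<lambda>j. nat (z j + k * int (a j))) i = int (m i)" by (simp add: q_def c_def)
    qed
    \<comment> \<open>The least first coordinate forces maximality: a weight one null root higher
      would have the same coroot values and first coordinate smaller by
      \<open>a 0 = 1\<close>.\<close>
    then obtain b where b: "?Q b" and least: "\<And>b'. ?Q b' \<Longrightarrow> b 0 \<le> b' 0"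
      using ex_has_least_nat[of ?Q _ "\<lambda>b. b 0"] by blast
    have nonneg: "\<forall>i\<le>n. q b i \<ge> 0" using b by simp
    have "(\<lambda>x. lower \<Lambda> b x + null_root x) \<notin> weights"
    proof
      assume "(\<lambda>x. lower \<Lambda> b x + null_root x) \<in> weights"
      then obtain b' where b': "(\<lambda>x. lower \<Lambda> b x + null_root x) = lower \<Lambda> b'"
        using weight_below_highest_weight[OF hw] by blast
      have eq: "lower \<Lambda> b = lower \<Lambda> (\<lambda>i. b' i + a i)"
        unfolding lower_plus_null_root b'[symmetric] by simp
      have b_eq: "b i = b' i + a i" if "i \<le> n" for i using lower_eqD[OF eq that] .
      have "q b i = q b' i" if "i \<le> n" for i
        using marks_kernel[OF that] b_eq by (simp add: q_def distrib_left sum.distrib)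
      then have "b 0 \<le> b' 0" using b by (intro least) auto
      then show False using b_eq[of 0] a0 by simp
    qed
    then have "lower \<Lambda> b \<in> max_dominant_weights"
      using in_weights[OF nonneg] dom nonneg by (simp add: max_dominant_weights_def maximal_weights_def)
    moreover have "g (lower \<Lambda> b) = m"
    proof
      fix i show "g (lower \<Lambda> b) i = m i"
      proof (cases "i \<le> n")
        case True
        then show ?thesis using g[OF nonneg True] b by simp
      next
        case False
        then show ?thesis using m by (simp add: g_def parity_compositions_def)
      qed
    qed
    ultimately show "m \<in> g ` max_dominant_weights" by blast
  qed
  ultimately show ?thesis by (auto simp: bij_betw_def)
qed

lemma card_max_dominant_weights:
  assumes "2 \<le> n" "A = cartan_C n" "a = marks_C n"
    and "highest_weight_module \<Lambda>" "Vector_Spaces.linear scaleH (*) \<Lambda>"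
    and "\<And>i. i \<le> n \<Longrightarrow> \<Lambda> (coroot i) = of_nat (L i)"
    and "(\<Sum>i\<le>n. L i) = l" "l > 0"
  shows "finite max_dominant_weights \<and>
    int (card max_dominant_weights) = (if even (\<Sum>i\<le>n. i * L i) then T0 n l else T1 n l)"
proof -
  obtain g where g: "bij_betw g max_dominant_weights (parity_compositions n l (\<Sum>i\<le>n. i * L i))"
    using ex_bij_betw_max_dominant_weights[of \<Lambda> L l, OF assms] by (rule exE)
  show ?thesis
    unfolding bij_betw_finite[OF g] bij_betw_same_card[OF g] card_parity_compositions
    by (simp only: finite_parity_compositions simp_thms)
qed

text \<open>In positive level, the weighted sum of the coroot values is 0 for the first highest
  weight and 1 for the second, so parity selects the array.\<close>

lemma card_max_dominant_weights_fundamental: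
  assumes n: "2 \<le> n" and C: "A = cartan_C n" "a = marks_C n"
  shows "is_V (\<lambda>x. of_nat l * fundamental_weight 0 x) \<Longrightarrow>
      finite max_dominant_weights \<and> int (card max_dominant_weights) = T0 n l"
    and "\<lbrakk>1 \<le> l; is_V (\<lambda>x. of_nat (l - 1) * fundamental_weight 0 x + fundamental_weight 1 x)\<rbrakk> \<Longrightarrow>
      finite max_dominant_weights \<and> int (card max_dominant_weights) = T1 n l"
proof -
  assume V: "is_V (\<lambda>x. of_nat l * fundamental_weight 0 x)"
  show "finite max_dominant_weights \<and> int (card max_dominant_weights) = T0 n l"
  proof (cases "l = 0")
    case True
    then show ?thesis using max_dominant_weights_trivial V by simp
  next
    case False
    let ?\<Lambda> = "\<lambda>x. of_nat l * fundamental_weight 0 x" and ?L = "\<lambda>i. if i = 0 then l else 0"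
    have "Vector_Spaces.linear scaleH (*) ?\<Lambda>"
      using linear_fundamental_weight[of 0] by (simp add: linear_functional_iff algebra_simps)
    moreover have "?\<Lambda> (coroot i) = of_nat (?L i)" if "i \<le> n" for i
      using that by (simp add: fundamental_weight_coroot)
    moreover have "(\<Sum>i\<le>n. ?L i) = l" by simp
    moreover have "even (\<Sum>i\<le>n. i * ?L i)" by (rule dvd_sum) simp
    ultimately show ?thesis
      using card_max_dominant_weights[of ?\<Lambda> ?L l, OF n C] V False by (simp add: is_V_def)
  qed
next
  let ?\<Lambda> = "\<lambda>x. of_nat (l - 1) * fundamental_weight 0 x + fundamental_weight 1 x"
  let ?L = "\<lambda>i. (if i = 0 then l - 1 else 0) + (if i = 1 then 1 else (0 :: nat))"
  assume l: "1 \<le> l" and V: "is_V ?\<Lambda>"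
  have "Vector_Spaces.linear scaleH (*) ?\<Lambda>"
    using linear_fundamental_weight[of 0] linear_fundamental_weight[of 1]
    by (simp add: linear_functional_iff algebra_simps)
  moreover have "?\<Lambda> (coroot i) = of_nat (?L i)" if "i \<le> n" for i
    using that n by (simp add: fundamental_weight_coroot)
  moreover have "(\<Sum>i\<le>n. ?L i) = l" using l n by (subst sum.distrib) simp
  moreover have "(\<Sum>i\<le>n. i * ?L i) = (\<Sum>i\<le>n. if i = 1 then 1 else 0)" by (intro sum.cong) auto
  then have "odd (\<Sum>i\<le>n. i * ?L i)" using n by simp
  ultimately show "finite max_dominant_weights \<and> int (card max_dominant_weights) = T1 n l"
    using card_max_dominant_weights[of ?\<Lambda> ?L l, OF n C] V l by (simp add: is_V_def)
qed

end

theorem mainTheorem14: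
  fixes n :: nat
    and scaleH :: "complex \<Rightarrow> 'h::ab_group_add \<Rightarrow> 'h"
    and coroot :: "nat \<Rightarrow> 'h" and d :: 'h and alpha :: "nat \<Rightarrow> 'h \<Rightarrow> complex"
    and scaleG :: "complex \<Rightarrow> 'g::ab_group_add \<Rightarrow> 'g" and bracket :: "'g \<Rightarrow> 'g \<Rightarrow> 'g"
    and cartan :: "'h \<Rightarrow> 'g" and e f :: "nat \<Rightarrow> 'g"
    and scaleV :: "complex \<Rightarrow> 'v::ab_group_add \<Rightarrow> 'v" and act :: "'g \<Rightarrow> 'v \<Rightarrow> 'v"
  defines "\<Lambda> \<equiv> affine_realization.fundamental_weight n scaleH coroot d"
    and "is_V \<equiv> affine_kac_moody_module.is_V n cartan e scaleV act"
    and "max_plus \<equiv> affine_kac_moody_module.max_dominant_weights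
           n (marks_C n) scaleH coroot alpha cartan scaleV act"
  assumes "n \<ge> 2"
    and "affine_kac_moody_module n (cartan_C n) (marks_C n) scaleH coroot d alpha
           scaleG bracket cartan e f scaleV act"
  shows "(\<forall>l. is_V (\<lambda>x. of_nat l * \<Lambda> 0 x) \<longrightarrow>
            finite max_plus \<and> int (card max_plus) = T0 n l) \<and>
         (\<forall>l\<ge>1. is_V (\<lambda>x. of_nat (l - 1) * \<Lambda> 0 x + \<Lambda> 1 x) \<longrightarrow>
            finite max_plus \<and> int (card max_plus) = T1 n l)"
proof -
  note defs = \<Lambda>_def is_V_def max_plus_def
  interpret affine_kac_moody_module n "cartan_C n" "marks_C n" scaleH coroot d alpha
    scaleG bracket cartan e f scaleV act by fact
  show ?thesis
    unfolding defs
    by (intro conjI[OF allI allI] impI card_max_dominant_weights_fundamental[OF \<open>n \<ge> 2\<close> refl refl])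
qed

end
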